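(* There does not exist any linear function $f(r)$ such that for every $r\ge1$ and every $(\lambda,\mu,\nu)$ in the Hilbert basis of ${\sf LR}_r^{\mathbb Z}$, one has $\nu_1\le f(r)$.
   Context: For partitions $\lambda,\mu,\nu$ with at most $r$ nonzero parts, $c_{\lambda,\mu}^{\nu}$ denotes the Littlewood–Richardson coefficient (the multiplicity of the Schur function $s_\nu$ in $s_\lambda s_\mu$; equivalently the number of semistandard tableaux of skew shape $\nu/\lambda$ and content $\mu$ whose right-to-left, top-to-bottom row reading word is a ballot sequence). ${\sf LR}_r^{\mathbb Z}=\{(\lambda,\mu,\nu):c_{\lambda,\mu}^{\nu}>0\}\subset\mathbb{Z}^{3r}$; it is a finitely generated semigroup under componentwise addition, equal to the set of lattice points of a pointed rational polyhedral cone ${\sf LR}_r$. Its Hilbert basis is the set of nonzero elements of ${\sf LR}_r^{\mathbb Z}$ that are not the sum of two nonzero elements of ${\sf LR}_r^{\mathbb Z}$. *)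

theory Defs
  imports Complex_Main "HOL-Library.Function_Algebras" "HOL-Library.Product_Plus"
begin

text \<open>
  Rows, columns and tableau entries are all numbered from 0: the part \<open>\<lambda>\<^sub>i\<close> of the usual
  notation is \<open>l (i - 1)\<close>, and the usual tableau entry \<open>k\<close> is represented by \<open>k - 1\<close>.
\<close>

definition partitions :: "nat \<Rightarrow> (nat \<Rightarrow> nat) set" where
  "partitions r = {l. antimono l \<and> (\<forall>i\<ge>r. l i = 0)}"

definition skew_cells :: "(nat \<Rightarrow> nat) \<Rightarrow> (nat \<Rightarrow> nat) \<Rightarrow> (nat \<times> nat) set" where
  "skew_cells n l = {(i, j). l i \<le> j \<and> j < n i}"

text \<open>
  Fillings are total functions; the value 0 outside the shape makes the representation of a
  tableau unique, so that tableaux can be counted by \<open>card\<close>.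
\<close>

definition skew_ssyt :: "(nat \<Rightarrow> nat) \<Rightarrow> (nat \<Rightarrow> nat) \<Rightarrow> (nat \<Rightarrow> nat) \<Rightarrow> (nat \<Rightarrow> nat \<Rightarrow> nat) set" where
  "skew_ssyt n l m = {T.
     (\<forall>i j. (i, j) \<notin> skew_cells n l \<longrightarrow> T i j = 0) \<and>
     (\<forall>i j. (i, j) \<in> skew_cells n l \<and> (i, Suc j) \<in> skew_cells n l \<longrightarrow> T i j \<le> T i (Suc j)) \<and>
     (\<forall>i j. (i, j) \<in> skew_cells n l \<and> (Suc i, j) \<in> skew_cells n l \<longrightarrow> T i j < T (Suc i) j) \<and>
     (\<forall>k. card {(i, j). (i, j) \<in> skew_cells n l \<and> T i j = k} = m k)}"

definition reading_word ::
    "nat \<Rightarrow> (nat \<Rightarrow> nat) \<Rightarrow> (nat \<Rightarrow> nat) \<Rightarrow> (nat \<Rightarrow> nat \<Rightarrow> nat) \<Rightarrow> nat list" where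
  "reading_word r n l T = concat (map (\<lambda>i. rev (map (T i) [l i..<n i])) [0..<r])"

definition ballot :: "nat list \<Rightarrow> bool" where
  "ballot w \<longleftrightarrow> (\<forall>p k. count_list (take p w) (Suc k) \<le> count_list (take p w) k)"

text \<open>
  The coefficient \<open>c\<^bsub>l,m\<^esub>\<^bsup>n\<^esup>\<close> for \<open>l, m, n \<in> partitions r\<close>; the parameter \<open>r\<close> only bounds the number
  of rows to be read.
\<close>

definition lr_coeff ::
    "nat \<Rightarrow> (nat \<Rightarrow> nat) \<Rightarrow> (nat \<Rightarrow> nat) \<Rightarrow> (nat \<Rightarrow> nat) \<Rightarrow> nat" where
  "lr_coeff r l m n =
     (if \<forall>i. l i \<le> n i then card {T \<in> skew_ssyt n l m. ballot (reading_word r n l T)} else 0)"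

definition LR_semigroup :: "nat \<Rightarrow> ((nat \<Rightarrow> nat) \<times> (nat \<Rightarrow> nat) \<times> (nat \<Rightarrow> nat)) set" where
  "LR_semigroup r = {(l, m, n). l \<in> partitions r \<and> m \<in> partitions r \<and> n \<in> partitions r \<and>
                                lr_coeff r l m n > 0}"

definition hilbert_basis :: "'a::monoid_add set \<Rightarrow> 'a set" where
  "hilbert_basis S = {x \<in> S. x \<noteq> 0 \<and> \<not> (\<exists>y\<in>S. \<exists>z\<in>S. y \<noteq> 0 \<and> z \<noteq> 0 \<and> x = y + z)}"

text \<open>The sets counted by \<^const>\<open>lr_coeff\<close> are finite, so \<open>card\<close> is not degenerate there.\<close>

lemma finite_skew_ssyt:
  assumes m: "m \<in> partitions r" and n: "n \<in> partitions r"
  shows "finite (skew_ssyt n l m)"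
proof -
  have sub: "skew_cells n l \<subseteq> {..<r} \<times> {..<n 0}"
  proof
    fix c assume "c \<in> skew_cells n l"
    then obtain i j where c: "c = (i, j)" "j < n i" by (auto simp: skew_cells_def)
    have "i < r" using c n by (force simp: partitions_def not_le[symmetric])
    moreover have "n i \<le> n 0" using n by (auto simp: partitions_def antimono_def)
    ultimately show "c \<in> {..<r} \<times> {..<n 0}" using c by auto
  qed
  then have fin: "finite (skew_cells n l)" by (rule finite_subset) auto
  have bound: "T i j < r" if T: "T \<in> skew_ssyt n l m" and ij: "(i, j) \<in> skew_cells n l" for T i j
  proof (rule ccontr)
    let ?A = "{(i', j'). (i', j') \<in> skew_cells n l \<and> T i' j' = T i j}"
    assume "\<not> T i j < r"
    then have "m (T i j) = 0" using m by (auto simp: partitions_def)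
    then have "card ?A = 0" using T by (auto simp: skew_ssyt_def)
    moreover have "finite ?A" by (rule finite_subset[OF _ fin]) auto
    ultimately show False using ij by auto
  qed
  have "finite {f. \<forall>c. (c \<in> skew_cells n l \<longrightarrow> f c \<in> {..<r}) \<and> (c \<notin> skew_cells n l \<longrightarrow> f c = 0)}"
    using fin by (rule finite_set_of_finite_funs) auto
  then have "finite (curry ` {f. \<forall>c. (c \<in> skew_cells n l \<longrightarrow> f c \<in> {..<r}) \<and>
                                      (c \<notin> skew_cells n l \<longrightarrow> f c = (0::nat))})"
    by (rule finite_imageI)
  moreover have "skew_ssyt n l m \<subseteq> curry ` {f. \<forall>c. (c \<in> skew_cells n l \<longrightarrow> f c \<in> {..<r}) \<and>
                                      (c \<notin> skew_cells n l \<longrightarrow> f c = (0::nat))}"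
  proof
    fix T assume T: "T \<in> skew_ssyt n l m"
    have "T = curry (case_prod T)" by simp
    moreover have "case_prod T \<in> {f. \<forall>c. (c \<in> skew_cells n l \<longrightarrow> f c \<in> {..<r}) \<and>
                                      (c \<notin> skew_cells n l \<longrightarrow> f c = (0::nat))}"
      using T bound[OF T] by (auto simp: skew_ssyt_def)
    ultimately show "T \<in> curry ` {f. \<forall>c. (c \<in> skew_cells n l \<longrightarrow> f c \<in> {..<r}) \<and>
                                      (c \<notin> skew_cells n l \<longrightarrow> f c = (0::nat))}"
      by (rule image_eqI)
  qed
  ultimately show ?thesis by (rule finite_subset[rotated])
qed

end

theory Submission imports Defs begin

text \<open>
  The Hilbert basis of \<open>LR\<^bsub>3k\<^esub>\<close> contains a triple with \<open>\<nu>\<^sub>1 = 2\<^sup>k\<close>. It is obtained by iterating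
  \<open>(\<lambda>', \<mu>', \<nu>') \<mapsto> ((y, y, \<lambda>'), (y, y, \<mu>'), (2y, y, y, \<nu>'))\<close> with \<open>y = \<nu>'\<^sub>1\<close>, starting from the zero triple
  with \<open>y = 1\<close>. In a Littlewood-Richardson tableau of the bigger triple the first row consists of all the
  entries 1, the second row is empty, and every column \<open>j \<le> y\<close> starts with an entry 2; deleting
  these entries and lowering the remaining ones by 2 gives a tableau of the smaller triple, and this is
  reversible.

  The new parts are pinned down by the inequalities \<open>\<nu>\<^sub>1 \<le> \<lambda>\<^sub>1 + \<mu>\<^sub>1\<close>, \<open>\<lambda>\<^sub>2 \<le> \<nu>\<^sub>2\<close>, \<open>\<mu>\<^sub>2 \<le> \<nu>\<^sub>2\<close> and the
  monotonicity of partitions, all of which are tight. Tight inequalities remain tight for both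
  summands of a decomposition, so each summand has the same recursive shape and is therefore
  an integer multiple of the triple itself; hence one of them vanishes.
\<close>

text \<open>Shifted indices stay in the form \<open>i + 2\<close>, in which the parts after the
  first two are addressed throughout.\<close>

declare add_2_eq_Suc' [simp del]

section \<open>Membership in the semigroup and basic facts on skew tableaux\<close>

lemma mem_LR_semigroup:
  "(l, m, n) \<in> LR_semigroup r \<longleftrightarrow>
     l \<in> partitions r \<and> m \<in> partitions r \<and> n \<in> partitions r \<and> (\<forall>i. l i \<le> n i) \<and>
     (\<exists>T\<in>skew_ssyt n l m. ballot (reading_word r n l T))"
proof -
  \<comment> \<open>Since \<open>card\<close> is 0 on infinite sets, finiteness is what turns a
    positive coefficient into the existence of one tableau, and back.\<close>
  have "finite {T \<in> skew_ssyt n l m. ballot (reading_word r n l T)}"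
    if "m \<in> partitions r" "n \<in> partitions r"
    using finite_skew_ssyt[OF that] by simp
  then show ?thesis
    by (auto simp: LR_semigroup_def lr_coeff_def card_gt_0_iff split: if_splits)
qed

lemma finite_skew_cells:
  assumes "n \<in> partitions r"
  shows "finite (skew_cells n l)"
proof (rule finite_subset)
  show "skew_cells n l \<subseteq> {..<r} \<times> {..<n 0}"
  proof
    fix c assume "c \<in> skew_cells n l"
    then obtain i j where c: "c = (i, j)" "j < n i" by (auto simp: skew_cells_def)
    have "i < r" using c assms by (force simp: partitions_def not_le[symmetric])
    moreover have "n i \<le> n 0" using assms by (auto simp: partitions_def antimono_def)
    ultimately show "c \<in> {..<r} \<times> {..<n 0}" using c by auto
  qed
qed auto

lemma partitions_antimono: "l \<in> partitions r \<Longrightarrow> i \<le> j \<Longrightarrow> l j \<le> l i"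
  by (auto simp: partitions_def antimono_def)

lemma skew_ssyt_content:
  "T \<in> skew_ssyt n l m \<Longrightarrow> card {(i, j). (i, j) \<in> skew_cells n l \<and> T i j = k} = m k"
  by (simp add: skew_ssyt_def)

lemma skew_ssyt_row_mono:
  assumes T: "T \<in> skew_ssyt n l m" and "j \<le> j'" and "l i \<le> j" and "j' < n i"
  shows "T i j \<le> T i j'"
  using assms(2,4)
proof (induction j' rule: dec_induct)
  case (step j')
  have "T i j' \<le> T i (Suc j')"
    using T step assms(3) by (auto simp: skew_ssyt_def skew_cells_def)
  with step show ?case by simp
qed simp

text \<open>The definition compares adjacent cells only. Because \<open>l\<close> and
  \<open>n\<close> are partitions, every cell between two cells of a column lies in the shape, so
  the comparisons chain.\<close>

lemma skew_ssyt_column_strict: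
  assumes T: "T \<in> skew_ssyt n l m" and l: "l \<in> partitions r" and n: "n \<in> partitions s"
    and "i < i'" and "l i \<le> j" and "j < n i'"
  shows "T i j < T i' j"
proof -
  from \<open>i < i'\<close> have "Suc i \<le> i'" by simp
  then show ?thesis using \<open>j < n i'\<close>
  proof (induction i' rule: dec_induct)
    case base
    then show ?case
      using T \<open>l i \<le> j\<close> partitions_antimono[OF l, of i "Suc i"] partitions_antimono[OF n, of i "Suc i"]
      by (auto simp: skew_ssyt_def skew_cells_def)
  next
    case (step k)
    have "T k j < T (Suc k) j"
      using T step.prems step.hyps \<open>l i \<le> j\<close>
        partitions_antimono[OF l, of i k] partitions_antimono[OF l, of k "Suc k"]
        partitions_antimono[OF n, of k "Suc k"]
      by (auto simp: skew_ssyt_def skew_cells_def)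
    moreover have "T i j < T k j"
      using step partitions_antimono[OF n, of k "Suc k"] by simp
    ultimately show ?case by simp
  qed
qed

text \<open>A strictly increasing column contains each value at most once, so the occurrences of a
  value can be counted by their columns.\<close>

lemma inj_on_snd_skew_ssyt_entry:
  assumes "T \<in> skew_ssyt n l m" and "l \<in> partitions r" and "n \<in> partitions s"
  shows "inj_on snd {(i, j). (i, j) \<in> skew_cells n l \<and> T i j = k}"
proof (rule inj_onI)
  fix c c' assume c: "c \<in> {(i, j). (i, j) \<in> skew_cells n l \<and> T i j = k}"
    "c' \<in> {(i, j). (i, j) \<in> skew_cells n l \<and> T i j = k}" and "snd c = snd c'"
  then obtain i i' j where ij: "c = (i, j)" "c' = (i', j)" by (cases c; cases c') auto
  have "\<not> i < i'" "\<not> i' < i"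
    using c ij skew_ssyt_column_strict[OF assms] by (fastforce simp: skew_cells_def)+
  with ij show "c = c'" by simp
qed

section \<open>Ballot words and deletion of the two smallest letters\<close>

lemma ballot_iff_append:
  "ballot w \<longleftrightarrow> (\<forall>u v k. w = u @ v \<longrightarrow> count_list u (Suc k) \<le> count_list u k)"
proof
  assume w: "ballot w"
  show "\<forall>u v k. w = u @ v \<longrightarrow> count_list u (Suc k) \<le> count_list u k"
  proof (intro allI impI)
    fix u v k assume "w = u @ v"
    then have "take (length u) w = u" by simp
    then show "count_list u (Suc k) \<le> count_list u k"
      using w unfolding ballot_def by metis
  qed
next
  assume "\<forall>u v k. w = u @ v \<longrightarrow> count_list u (Suc k) \<le> count_list u k"
  then show "ballot w" unfolding ballot_def by (metis append_take_drop_id)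
qed

text \<open>The effect on the reading word of passing to the smaller tableau: the entries 0 and 1
  disappear and all others drop by 2.\<close>

definition drop_letters :: "nat list \<Rightarrow> nat list" where
  "drop_letters w = map (\<lambda>x. x - 2) (filter (\<lambda>x. 2 \<le> x) w)"

lemma drop_letters_append [simp]: "drop_letters (u @ v) = drop_letters u @ drop_letters v"
  by (simp add: drop_letters_def)

lemma drop_letters_Nil [simp]: "drop_letters [] = []"
  by (simp add: drop_letters_def)

lemma drop_letters_rev: "drop_letters (rev u) = rev (drop_letters u)"
  by (simp add: drop_letters_def rev_map rev_filter)

lemma drop_letters_small: "(\<And>x. x \<in> set w \<Longrightarrow> x < 2) \<Longrightarrow> drop_letters w = []"
  by (fastforce simp: drop_letters_def filter_empty_conv)

lemma drop_letters_concat: "drop_letters (concat ws) = concat (map drop_letters ws)"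
  by (induction ws) auto

lemma count_list_drop_letters: "count_list (drop_letters w) k = count_list w (k + 2)"
  by (induction w) (auto simp: drop_letters_def)

text \<open>Lifting a prefix of the reduced word to a prefix of the original one lets the ballot
  condition descend.\<close>

lemma drop_letters_eq_append:
  "drop_letters w = u @ v \<Longrightarrow> \<exists>u' v'. w = u' @ v' \<and> drop_letters u' = u"
proof (induction w arbitrary: u)
  case Nil
  then show ?case by auto
next
  case (Cons x w)
  show ?case
  proof (cases "x < 2")
    case True
    then have "drop_letters (x # w) = drop_letters w" by (simp add: drop_letters_def)
    with Cons obtain u' v' where "w = u' @ v'" "drop_letters u' = u" by metis
    with True have "x # w = (x # u') @ v' \<and> drop_letters (x # u') = u"
      by (simp add: drop_letters_def)
    then show ?thesis by blast
  next
    case False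
    then have x: "drop_letters (x # w') = (x - 2) # drop_letters w'" for w'
      by (simp add: drop_letters_def)
    show ?thesis
    proof (cases u)
      case Nil
      then show ?thesis by (metis append_Nil drop_letters_Nil)
    next
      case (Cons y u1)
      with Cons.prems x have "drop_letters w = u1 @ v" "y = x - 2" by auto
      with Cons.IH obtain u' v' where "w = u' @ v'" "drop_letters u' = u1" by metis
      with x Cons \<open>y = x - 2\<close> have "x # w = (x # u') @ v' \<and> drop_letters (x # u') = u" by simp
      then show ?thesis by blast
    qed
  qed
qed

text \<open>The comparisons of letters \<open>k\<close> and \<open>Suc k\<close> with
  \<open>k\<close> at least 2 involve surviving letters only and form the ballot condition of the
  reduced word. What is left is to compare 0 with 1 and 1 with 2.\<close>

lemma ballot_drop_letters_iff:
  "ballot w \<longleftrightarrow> ballot (drop_letters w) \<and>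
     (\<forall>u v. w = u @ v \<longrightarrow> count_list u 1 \<le> count_list u 0 \<and> count_list u 2 \<le> count_list u 1)"
  (is "_ \<longleftrightarrow> ?R")
proof
  assume w: "ballot w"
  have "ballot (drop_letters w)"
    unfolding ballot_iff_append
  proof (intro allI impI)
    fix u v k assume "drop_letters w = u @ v"
    then obtain u' v' where "w = u' @ v'" "drop_letters u' = u"
      using drop_letters_eq_append by blast
    moreover from this w have "count_list u' (Suc (k + 2)) \<le> count_list u' (k + 2)"
      unfolding ballot_iff_append by blast
    ultimately show "count_list u (Suc k) \<le> count_list u k"
      by (metis count_list_drop_letters add_Suc)
  qed
  moreover have "count_list u 1 \<le> count_list u 0 \<and> count_list u 2 \<le> count_list u 1"
    if "w = u @ v" for u v
    using w that unfolding ballot_iff_append by (metis One_nat_def Suc_1)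
  ultimately show ?R by blast
next
  assume R: ?R
  show "ballot w"
    unfolding ballot_iff_append
  proof (intro allI impI)
    fix u v and k :: nat assume w: "w = u @ v"
    consider "k = 0" | "k = 1" | k' :: nat where "k = k' + 2"
      using le_Suc_ex[of 2 k] by (metis One_nat_def add.commute less_2_cases not_le)
    then show "count_list u (Suc k) \<le> count_list u k"
    proof cases
      case 3
      have "drop_letters w = drop_letters u @ drop_letters v" using w by simp
      with R have "count_list (drop_letters u) (Suc k') \<le> count_list (drop_letters u) k'"
        unfolding ballot_iff_append by blast
      then show ?thesis unfolding 3 count_list_drop_letters by simp
    qed (use R w in \<open>auto simp: numeral_2_eq_2\<close>)
  qed
qed

section \<open>Linear inequalities valid on the whole semigroup\<close>

lemma ballot_first_letter: "ballot (x # w) \<Longrightarrow> x = 0"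
proof (cases x)
  case (Suc k)
  assume "ballot (x # w)"
  then have "count_list [x] (Suc k) \<le> count_list [x] k"
    unfolding ballot_iff_append by (metis append_Cons append_Nil)
  with Suc show ?thesis by simp
qed

text \<open>Reading starts at the right end of row 0, so the largest entry of that row is the first
  letter of a ballot word and hence 0.\<close>

lemma skew_ssyt_first_row:
  assumes T: "T \<in> skew_ssyt n l m" and w: "ballot (reading_word (Suc r) n l T)"
    and j: "l 0 \<le> j" "j < n 0"
  shows "T 0 j = 0"
proof -
  define n' where "n' = n 0 - 1"
  have n': "n 0 = Suc n'" "l 0 \<le> n'" "j \<le> n'" using j by (auto simp: n'_def)
  have "[0..<Suc r] = 0 # map Suc [0..<r]" by (simp add: upt_conv_Cons map_Suc_upt)
  then have "reading_word (Suc r) n l T =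
      T 0 n' # rev (map (T 0) [l 0..<n']) @ concat (map (\<lambda>i. rev (map (T i) [l i..<n i])) (map Suc [0..<r]))"
    using n' unfolding reading_word_def by simp
  with w have "T 0 n' = 0" by (metis ballot_first_letter)
  moreover have "T 0 j \<le> T 0 n'" using skew_ssyt_row_mono[OF T n'(3) j(1)] n' by simp
  ultimately show ?thesis by simp
qed

text \<open>Row 0 has \<open>n 0 - l 0\<close> cells, all filled with 0, and only \<open>m 0\<close>
  zeros are available.\<close>

lemma LR_semigroup_first_part_le:
  assumes "(l, m, n) \<in> LR_semigroup (Suc r)"
  shows "n 0 \<le> l 0 + m 0"
proof -
  from assms obtain T where T: "T \<in> skew_ssyt n l m" "ballot (reading_word (Suc r) n l T)"
    and n: "n \<in> partitions (Suc r)"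
    by (auto simp: mem_LR_semigroup)
  let ?C = "{(i, j). (i, j) \<in> skew_cells n l \<and> T i j = 0}"
  have "{0} \<times> {l 0..<n 0} \<subseteq> ?C"
    using skew_ssyt_first_row[OF T] by (auto simp: skew_cells_def)
  moreover have "finite ?C" by (rule finite_subset[OF _ finite_skew_cells[OF n]]) auto
  ultimately have "card ({0::nat} \<times> {l 0..<n 0}) \<le> card ?C" by (intro card_mono)
  then show ?thesis using skew_ssyt_content[OF T(1), of 0] by simp
qed

text \<open>Row 0 holds only zeros, so an entry 1 lies in a lower row, none of which is longer than
  row 1. As these entries occupy distinct columns, this bounds \<open>m 1\<close> by
  \<open>n 1\<close>.\<close>

lemma skew_ssyt_second_entry_columns:
  assumes T: "T \<in> skew_ssyt n l m" and w: "ballot (reading_word (Suc r) n l T)"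
    and n: "n \<in> partitions s"
  shows "snd ` {(i, j). (i, j) \<in> skew_cells n l \<and> T i j = 1} \<subseteq> {..<n 1}"
proof clarsimp
  fix i j assume ij: "(i, j) \<in> skew_cells n l" "T i j = Suc 0"
  have "i \<noteq> 0" using ij skew_ssyt_first_row[OF T w] by (cases i) (auto simp: skew_cells_def)
  then show "j < n (Suc 0)"
    using ij partitions_antimono[OF n, of 1 i] by (auto simp: skew_cells_def)
qed

lemma LR_semigroup_second_part_le:
  assumes "(l, m, n) \<in> LR_semigroup (Suc r)"
  shows "m 1 \<le> n 1"
proof -
  from assms obtain T where T: "T \<in> skew_ssyt n l m" "ballot (reading_word (Suc r) n l T)"
    and n: "n \<in> partitions (Suc r)" and l: "l \<in> partitions (Suc r)"
    by (auto simp: mem_LR_semigroup)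
  have "card (snd ` {(i, j). (i, j) \<in> skew_cells n l \<and> T i j = 1}) \<le> card {..<n 1}"
    by (intro card_mono skew_ssyt_second_entry_columns[OF T n]) simp
  then show ?thesis
    by (simp only: card_image[OF inj_on_snd_skew_ssyt_entry[OF T(1) l n]] skew_ssyt_content[OF T(1)]
        card_lessThan)
qed

section \<open>Removing the outermost layer of a triple\<close>

lemma upt_split: "a \<le> b \<Longrightarrow> b \<le> c \<Longrightarrow> [a..<c] = [a..<b] @ [b..<c]"
  using upt_add_eq_append[of a b "c - b"] by simp

lemma reading_word_add_3:
  "reading_word (r + 3) n l T =
     rev (map (T 0) [l 0..<n 0]) @ rev (map (T 1) [l 1..<n 1]) @ rev (map (T 2) [l 2..<n 2]) @
     concat (map (\<lambda>i. rev (map (T (i + 3)) [l (i + 3)..<n (i + 3)])) [0..<r])"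
proof -
  have "[0..<r + 3] = [0..<3] @ [3..<r + 3]" by (rule upt_split) simp_all
  also have "[3..<r + 3] = map (\<lambda>i. i + 3) [0..<r]" by (simp add: map_add_upt)
  also have "[0..<3] = [0, 1, 2::nat]" by (simp add: upt_rec)
  finally show ?thesis by (simp add: reading_word_def comp_def)
qed

text \<open>Shared by removal and insertion. Rows 0 to 2 lose all their letters; row
  \<open>i + 3\<close> splits at column \<open>l (i + 2)\<close> into a strip of ones, which
  vanishes, and a shifted copy of row \<open>i\<close> of \<open>T'\<close>.\<close>

lemma drop_letters_reading_word:
  assumes row0: "\<And>j. l 0 \<le> j \<Longrightarrow> j < n 0 \<Longrightarrow> T 0 j = 0" and row1: "n 1 \<le> l 1"
    and row2: "\<And>j. l 2 \<le> j \<Longrightarrow> j < n 2 \<Longrightarrow> T 2 j = 1"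
    and le: "\<And>i. l (i + 3) \<le> l (i + 2)" "\<And>i. l (i + 2) \<le> n (i + 3)"
    and strip: "\<And>i j. l (i + 3) \<le> j \<Longrightarrow> j < l (i + 2) \<Longrightarrow> T (i + 3) j = 1"
    and rest: "\<And>i j. l (i + 2) \<le> j \<Longrightarrow> j < n (i + 3) \<Longrightarrow> T (i + 3) j = T' i j + 2"
  shows "drop_letters (reading_word (r + 3) n l T) = reading_word r (\<lambda>i. n (i + 3)) (\<lambda>i. l (i + 2)) T'"
proof -
  have row: "drop_letters (rev (map (T (i + 3)) [l (i + 3)..<n (i + 3)])) =
      rev (map (T' i) [l (i + 2)..<n (i + 3)])" for i
  proof -
    have "[l (i + 3)..<n (i + 3)] = [l (i + 3)..<l (i + 2)] @ [l (i + 2)..<n (i + 3)]"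
      using le by (intro upt_split)
    moreover have "drop_letters (map (T (i + 3)) [l (i + 3)..<l (i + 2)]) = []"
      using strip by (intro drop_letters_small) auto
    moreover have "map (T (i + 3)) [l (i + 2)..<n (i + 3)] =
        map (\<lambda>j. T' i j + 2) [l (i + 2)..<n (i + 3)]"
      using rest by simp
    moreover have "drop_letters (map (\<lambda>j. T' i j + 2) [l (i + 2)..<n (i + 3)]) =
        map (T' i) [l (i + 2)..<n (i + 3)]"
      by (simp add: drop_letters_def filter_map comp_def)
    ultimately show ?thesis by (simp only: drop_letters_rev map_append drop_letters_append append_Nil)
  qed
  have "drop_letters (rev (map (T 0) [l 0..<n 0])) = []"
    using row0 by (intro drop_letters_small) auto
  moreover have "drop_letters (rev (map (T 2) [l 2..<n 2])) = []"
    using row2 by (intro drop_letters_small) auto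
  moreover have "drop_letters (rev (map (T 1) [l 1..<n 1])) = []"
    using row1 by simp
  ultimately show ?thesis
    unfolding reading_word_add_3 drop_letters_append drop_letters_concat map_map comp_def row
    by (simp add: reading_word_def)
qed

text \<open>Counting leaves no freedom for the entries 0 and 1: the zeros fill row 0, and each of
  the first \<open>y\<close> columns has exactly one 1, at its top. Below these tops all entries are
  at least 2. The condition on \<open>m (r + 2)\<close> keeps the shortened \<open>m\<close> within
  \<open>r\<close> parts.\<close>

lemma LR_semigroup_remove:
  assumes LR: "(l, m, n) \<in> LR_semigroup (r + 3)"
    and l01: "l 0 = y" "l 1 = y" and m01: "m 0 = y" "m 1 = y" and m_last: "m (r + 2) = 0"
    and n012: "n 0 = 2 * y" "n 1 = y" "n 2 = y"
  shows "(\<lambda>i. l (i + 2), \<lambda>i. m (i + 2), \<lambda>i. n (i + 3)) \<in> LR_semigroup r"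
proof -
  from LR obtain T where T: "T \<in> skew_ssyt n l m" and w: "ballot (reading_word (r + 3) n l T)"
    and l: "l \<in> partitions (r + 3)" and m: "m \<in> partitions (r + 3)" and n: "n \<in> partitions (r + 3)"
    and ln: "\<And>i. l i \<le> n i"
    by (auto simp: mem_LR_semigroup)
  have w': "ballot (reading_word (Suc (r + 2)) n l T)" using w by (simp add: numeral_3_eq_3)
  define C where "C k = {(i, j). (i, j) \<in> skew_cells n l \<and> T i j = k}" for k
  have fin: "finite (C k)" for k
    by (rule finite_subset[OF _ finite_skew_cells[OF n]]) (auto simp: C_def)
  have cardC: "card (C k) = m k" for k using skew_ssyt_content[OF T] by (simp add: C_def)
  have row0: "T 0 j = 0" if "y \<le> j" "j < 2 * y" for j
    using skew_ssyt_first_row[OF T w'] that l01 n012 by simp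
  \<comment> \<open>Row 0 already uses up all \<open>m 0 = y\<close> zeros.\<close>
  have C0: "{0} \<times> {y..<2 * y} = C 0"
  proof (rule card_subset_eq[OF fin])
    show "{0} \<times> {y..<2 * y} \<subseteq> C 0"
      using row0 l01 n012 by (auto simp: C_def skew_cells_def)
    show "card ({0::nat} \<times> {y..<2 * y}) = card (C 0)"
      unfolding cardC m01 by simp
  qed
  have pos: "1 \<le> T i j" if "(i, j) \<in> skew_cells n l" "i \<noteq> 0" for i j
  proof -
    have "(i, j) \<notin> C 0" using that unfolding C0[symmetric] by simp
    then show ?thesis using that by (auto simp: C_def Suc_le_eq)
  qed
  \<comment> \<open>The \<open>y\<close> entries 1 lie in distinct columns, all to the left of
    column \<open>y\<close>, so they meet each of these columns.\<close>
  have "snd ` C 1 = {..<y}"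
  proof (rule card_subset_eq)
    show "snd ` C 1 \<subseteq> {..<y}"
      using skew_ssyt_second_entry_columns[OF T w' n] n012 by (simp add: C_def)
    show "card (snd ` C 1) = card {..<y}"
      using card_image[OF inj_on_snd_skew_ssyt_entry[OF T l n, of 1]] cardC[of 1] m01 by (simp add: C_def)
  qed simp
  \<comment> \<open>Rows 0 and 1 start only at column \<open>y\<close>, so the 1 of an earlier
    column lies in row 2 or below.\<close>
  then have column: "\<exists>i. l i \<le> j \<and> j < n i \<and> T i j = 1 \<and> 2 \<le> i" if "j < y" for j
  proof -
    from that \<open>snd ` C 1 = {..<y}\<close> have "j \<in> snd ` C 1" by simp
    then obtain i where i: "l i \<le> j" "j < n i" "T i j = 1" by (auto simp: C_def skew_cells_def)
    moreover have "i \<noteq> 0" "i \<noteq> 1" using i(1) that l01 by (metis not_le)+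
    ultimately show ?thesis by (intro exI[of _ i]) auto
  qed
  \<comment> \<open>A 1 further down in the column would force an entry below 1 here, but all zeros
    are in row 0.\<close>
  have row2: "T 2 j = 1" if j: "l 2 \<le> j" "j < n 2" for j
  proof -
    from column[of j] j n012 obtain i where i: "l i \<le> j" "j < n i" "T i j = 1" "2 \<le> i" by auto
    show ?thesis
    proof (cases "i = 2")
      case False
      then have "T 2 j < 1" using skew_ssyt_column_strict[OF T l n, of 2 i j] i j by simp
      then show ?thesis using pos[of 2 j] j by (simp add: skew_cells_def)
    qed (use i in simp)
  qed
  \<comment> \<open>Otherwise column \<open>n (i + 3)\<close> would have no cell: the rows up to
    \<open>i + 2\<close> start to the right of it and the later rows end before it. But it must
    contain a 1.\<close>
  have l_le_n: "l (i + 2) \<le> n (i + 3)" for i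
  proof (rule ccontr)
    assume neg: "\<not> l (i + 2) \<le> n (i + 3)"
    then have "n (i + 3) < y" using partitions_antimono[OF l, of 0 "i + 2"] l01 by simp
    then obtain i' where i': "l i' \<le> n (i + 3)" "n (i + 3) < n i'" using column by blast
    have "i' < i + 3"
      using i' partitions_antimono[OF n, of "i + 3" i'] by (meson leD not_le)
    then have "l (i + 2) \<le> l i'" by (intro partitions_antimono[OF l]) simp
    with i' neg show False by simp
  qed
  \<comment> \<open>The cell \<open>(i + 3, j)\<close> is the topmost one of its column, so the
    argument for row 2 applies again.\<close>
  have strip: "T (i + 3) j = 1" if j: "l (i + 3) \<le> j" "j < l (i + 2)" for i j
  proof -
    have jn: "j < n (i + 3)" using j l_le_n[of i] by simp
    have "j < y" using j partitions_antimono[OF l, of 0 "i + 2"] l01 by simp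
    then obtain i' where i': "l i' \<le> j" "j < n i'" "T i' j = 1" using column by blast
    have "i + 3 \<le> i'"
    proof (rule ccontr)
      assume "\<not> i + 3 \<le> i'"
      then have "l (i + 2) \<le> l i'" by (intro partitions_antimono[OF l]) simp
      with i' j show False by simp
    qed
    show ?thesis
    proof (cases "i' = i + 3")
      case False
      then have "T (i + 3) j < 1"
        using skew_ssyt_column_strict[OF T l n, of "i + 3" i' j] i' j \<open>i + 3 \<le> i'\<close> by simp
      then show ?thesis using pos[of "i + 3" j] j jn by (simp add: skew_cells_def)
    qed (use i' in simp)
  qed
  have rest: "2 \<le> T (i + 3) j" if j: "l (i + 2) \<le> j" "j < n (i + 3)" for i j
  proof -
    have "j < n (i + 2)" using j partitions_antimono[OF n, of "i + 2" "i + 3"] by simp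
    then have "1 \<le> T (i + 2) j" using pos[of "i + 2" j] j by (simp add: skew_cells_def)
    moreover have "T (i + 2) j < T (i + 3) j"
      using skew_ssyt_column_strict[OF T l n, of "i + 2" "i + 3" j] j by simp
    ultimately show ?thesis by simp
  qed

  define l' m' n' where "l' = (\<lambda>i. l (i + 2))" and "m' = (\<lambda>i. m (i + 2))" and "n' = (\<lambda>i. n (i + 3))"
  \<comment> \<open>The value 0 outside the shape is demanded by \<open>skew_ssyt\<close>; inside,
    \<open>rest\<close> makes the truncated subtraction exact.\<close>
  define T' where "T' i j = (if (i, j) \<in> skew_cells n' l' then T (i + 3) j - 2 else 0)" for i j
  have cells: "(i, j) \<in> skew_cells n' l' \<longleftrightarrow> l (i + 2) \<le> j \<and> j < n (i + 3)" for i j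
    by (simp add: skew_cells_def l'_def n'_def)
  have "n' \<in> partitions r" using n by (auto simp: partitions_def n'_def antimono_def)
  moreover have "l' \<in> partitions r"
  proof -
    \<comment> \<open>Row \<open>i + 3\<close> of \<open>n\<close> vanishes for these
      \<open>i\<close>, and \<open>l_le_n\<close> transfers this to
      \<open>l (i + 2)\<close>.\<close>
    have "l' i = 0" if "r \<le> i" for i
      using l_le_n[of i] that n by (simp add: l'_def partitions_def)
    then show ?thesis using l by (auto simp: partitions_def l'_def antimono_def)
  qed
  moreover have "m' \<in> partitions r"
  proof -
    have "m' i = 0" if "r \<le> i" for i
      using partitions_antimono[OF m, of "r + 2" "i + 2"] that m_last by (simp add: m'_def)
    then show ?thesis using m by (auto simp: partitions_def m'_def antimono_def)
  qed
  moreover have "T' \<in> skew_ssyt n' l' m'"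
    unfolding skew_ssyt_def
  proof (intro CollectI conjI allI impI)
    fix i j assume "(i, j) \<notin> skew_cells n' l'"
    then show "T' i j = 0" by (simp add: T'_def)
  next
    fix i j assume c: "(i, j) \<in> skew_cells n' l' \<and> (i, Suc j) \<in> skew_cells n' l'"
    have "T (i + 3) j \<le> T (i + 3) (Suc j)"
      using c partitions_antimono[OF l, of "i + 2" "i + 3"]
      by (intro skew_ssyt_row_mono[OF T]) (auto simp: cells)
    then show "T' i j \<le> T' i (Suc j)" using c by (simp add: T'_def)
  next
    fix i j assume c: "(i, j) \<in> skew_cells n' l' \<and> (Suc i, j) \<in> skew_cells n' l'"
    have "T (i + 3) j < T (Suc i + 3) j"
      using c partitions_antimono[OF l, of "i + 2" "i + 3"]
      by (intro skew_ssyt_column_strict[OF T l n]) (auto simp: cells)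
    moreover have "2 \<le> T (i + 3) j" using rest c by (auto simp: cells)
    ultimately show "T' i j < T' (Suc i) j" using c by (simp add: T'_def)
  next
    fix k
    let ?D = "{(i, j). (i, j) \<in> skew_cells n' l' \<and> T' i j = k}"
    \<comment> \<open>An entry of at least 2 avoids row 0 (zeros), row 1 (empty), row 2 (ones) and
      the strips of ones, so moving up by three rows is a bijection.\<close>
    have "C (k + 2) = (\<lambda>(i, j). (i + 3, j)) ` ?D"
    proof (intro set_eqI iffI)
      fix c assume "c \<in> C (k + 2)"
      then obtain i j where c: "c = (i, j)" "l i \<le> j" "j < n i" "T i j = k + 2"
        by (auto simp: C_def skew_cells_def)
      have "i \<noteq> 0" using c row0[of j] l01 n012 by (cases i) auto
      moreover have "i \<noteq> 1" using c l01 n012 by auto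
      moreover have "i \<noteq> 2" using c row2 by auto
      ultimately have "i = (i - 3) + 3" by arith
      then obtain i' where i': "i = i' + 3" ..
      have "l (i' + 2) \<le> j" using strip[of i' j] c i' by (cases "l (i' + 2) \<le> j") simp_all
      then have "(i', j) \<in> ?D" using c i' by (auto simp: T'_def cells)
      then show "c \<in> (\<lambda>(i, j). (i + 3, j)) ` ?D" using c i' by force
    next
      fix c assume "c \<in> (\<lambda>(i, j). (i + 3, j)) ` ?D"
      then obtain i j where c: "c = (i + 3, j)" "(i, j) \<in> skew_cells n' l'" "T' i j = k" by auto
      then show "c \<in> C (k + 2)"
        using rest[of i j] partitions_antimono[OF l, of "i + 2" "i + 3"]
        by (auto simp: C_def skew_cells_def T'_def l'_def n'_def)
    qed
    moreover have "inj_on (\<lambda>(i, j). (i + 3, j)) ?D" by (auto simp: inj_on_def)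
    ultimately have "card ?D = card (C (k + 2))" by (simp only: card_image)
    then show "card ?D = m' k" using cardC by (simp add: m'_def)
  qed
  moreover have "ballot (reading_word r n' l' T')"
  proof -
    have "drop_letters (reading_word (r + 3) n l T) = reading_word r n' l' T'"
      unfolding l'_def n'_def
    proof (rule drop_letters_reading_word)
      fix i j assume "l (i + 2) \<le> j" "j < n (i + 3)"
      then show "T (i + 3) j = T' i j + 2" using rest[of i j] by (simp add: T'_def cells)
    qed (use row0 row2 strip l01 n012 l_le_n partitions_antimono[OF l] in auto)
    then show ?thesis using w ballot_drop_letters_iff by metis
  qed
  ultimately show ?thesis
    using l_le_n unfolding mem_LR_semigroup l'_def m'_def n'_def by blast
qed

section \<open>Adding a layer to a triple\<close>

lemma count_list_row: "count_list (rev (map g [a..<b])) k = card {j \<in> {a..<b}. g j = k}"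
proof -
  have "count_list (rev (map g [a..<b])) k = length (filter (\<lambda>j. g j = k) [a..<b])"
    by (simp add: count_list_eq_length_filter filter_map comp_def eq_commute flip: rev_filter)
  also have "\<dots> = card ({j. g j = k} \<inter> set [a..<b])" by (rule distinct_length_filter) simp
  also have "{j. g j = k} \<inter> set [a..<b] = {j \<in> {a..<b}. g j = k}" by auto
  finally show ?thesis .
qed

lemma concat_rows_eq_append:
  assumes "concat (map f [0..<r]) = u @ v"
  shows "u = [] \<or> (\<exists>i<r. \<exists>q s. f i = q @ s \<and> u = concat (map f [0..<i]) @ q)"
  using assms
proof (induction r arbitrary: v)
  case (Suc r)
  then have "concat (map f [0..<r]) @ f r = u @ v" by simp
  then consider q where "u = concat (map f [0..<r]) @ q" "f r = q @ v"
    | q where "concat (map f [0..<r]) = u @ q"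
    by (auto simp: append_eq_append_conv2)
  then show ?case
    by cases (use Suc.IH less_Suc_eq in blast)+
qed simp

text \<open>A prefix ending inside row \<open>i\<close> contains at most the letters
  \<open>b\<close> read through the end of row \<open>i\<close>, and at least the letters
  \<open>a\<close> read before row \<open>i\<close>. So it suffices to compare whole rows.\<close>

lemma count_list_prefix_le_if_rows:
  fixes f :: "nat \<Rightarrow> nat list"
  assumes "concat (map f [0..<r]) = u @ v"
    and rows: "\<And>i. i < r \<Longrightarrow>
      count_list (concat (map f [0..<Suc i])) b \<le> count_list (concat (map f [0..<i])) a"
  shows "count_list u b \<le> count_list u a"
  using concat_rows_eq_append[OF assms(1)]
proof (elim disjE exE conjE)
  fix i q s assume "i < r" "f i = q @ s" "u = concat (map f [0..<i]) @ q"
  then show ?thesis using rows[of i] by simp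
qed simp

text \<open>Converse of the removal: row 0 receives zeros, the top cell of each of the first
  \<open>y\<close> columns a 1, and the remaining cells the old entries raised by 2. The bounds on
  \<open>m 2\<close> and \<open>n 3\<close> keep the extended sequences weakly decreasing.\<close>

lemma LR_semigroup_insert:
  assumes LR: "(\<lambda>i. l (i + 2), \<lambda>i. m (i + 2), \<lambda>i. n (i + 3)) \<in> LR_semigroup r"
    and l01: "l 0 = y" "l 1 = y" and m01: "m 0 = y" "m 1 = y" and m2: "m 2 \<le> y"
    and n012: "n 0 = 2 * y" "n 1 = y" "n 2 = y" and n3: "n 3 \<le> y"
  shows "(l, m, n) \<in> LR_semigroup (r + 3)"
proof -
  define l' m' n' where "l' = (\<lambda>i. l (i + 2))" and "m' = (\<lambda>i. m (i + 2))" and "n' = (\<lambda>i. n (i + 3))"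
  from LR obtain T' where T': "T' \<in> skew_ssyt n' l' m'" and w': "ballot (reading_word r n' l' T')"
    and l': "l' \<in> partitions r" and m': "m' \<in> partitions r" and n': "n' \<in> partitions r"
    and le: "\<And>i. l (i + 2) \<le> n (i + 3)"
    unfolding mem_LR_semigroup l'_def m'_def n'_def by auto
  have shift: "i = 0 \<or> i = 1 \<or> (\<exists>k. i = k + 2)" "i = 0 \<or> i = 1 \<or> i = 2 \<or> (\<exists>k. i = k + 3)" for i :: nat
    by presburger+
  have l2: "l 2 \<le> y" using le[of 0] n3 by simp
  have l_Suc: "l (i + 3) \<le> l (i + 2)" for i
    using partitions_antimono[OF l', of i "Suc i"] by (simp add: l'_def numeral_3_eq_3)
  have n_Suc: "n (i + 4) \<le> n (i + 3)" for i
    using partitions_antimono[OF n', of i "Suc i"] by (simp add: n'_def add.commute)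
  have l: "l \<in> partitions (r + 3)"
  proof -
    have "l (Suc i) \<le> l i" for i
      using shift(1)[of i] l_Suc l01 l2 by (auto simp: numeral_3_eq_3 numeral_2_eq_2)
    moreover have "l i = 0" if "r + 3 \<le> i" for i
      using l' that shift(1)[of i] by (auto simp: partitions_def l'_def)
    ultimately show ?thesis by (simp add: partitions_def antimono_iff_le_Suc)
  qed
  have m: "m \<in> partitions (r + 3)"
  proof -
    have "m (Suc (i + 2)) \<le> m (i + 2)" for i
      using partitions_antimono[OF m', of i "Suc i"] by (simp add: m'_def)
    then have "m (Suc i) \<le> m i" for i
      using shift(1)[of i] m01 m2 by (auto simp: numeral_2_eq_2)
    moreover have "m i = 0" if "r + 3 \<le> i" for i
      using m' that shift(1)[of i] by (auto simp: partitions_def m'_def)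
    ultimately show ?thesis by (simp add: partitions_def antimono_iff_le_Suc)
  qed
  have n: "n \<in> partitions (r + 3)"
  proof -
    have "n (Suc i) \<le> n i" for i
      using shift(2)[of i] n_Suc n012 n3 by (auto simp: eval_nat_numeral)
    moreover have "n i = 0" if "r + 3 \<le> i" for i
      using n' that shift(2)[of i] by (auto simp: partitions_def n'_def)
    ultimately show ?thesis by (simp add: partitions_def antimono_iff_le_Suc)
  qed
  have ln: "l i \<le> n i" for i
    using shift(2)[of i] l01 n012 l2 order_trans[OF l_Suc le] by auto

  \<comment> \<open>The test \<open>j < l (i - 1)\<close> says that no cell of the shape lies
    directly above; cells of row 2 are tops because row 1 is empty.\<close>
  define T where "T i j = (if (i, j) \<notin> skew_cells n l \<or> i = 0 then 0
    else if i = 2 \<or> j < l (i - 1) then 1 else T' (i - 3) j + 2)" for i j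
  have row0: "T 0 j = 0" for j by (simp add: T_def)
  have row2: "T 2 j = 1" if "l 2 \<le> j" "j < n 2" for j
    using that by (simp add: T_def skew_cells_def)
  have strip: "T (i + 3) j = 1" if "l (i + 3) \<le> j" "j < l (i + 2)" for i j
  proof -
    have "j < n (i + 3)" using that le[of i] by simp
    then show ?thesis using that by (simp add: T_def skew_cells_def numeral_3_eq_3 numeral_2_eq_2)
  qed
  have rest: "T (i + 3) j = T' i j + 2" if "l (i + 2) \<le> j" "j < n (i + 3)" for i j
  proof -
    have "l (i + 3) \<le> j" using that l_Suc[of i] by simp
    then show ?thesis using that by (simp add: T_def skew_cells_def numeral_3_eq_3 numeral_2_eq_2)
  qed
  define C where "C k = {(i, j). (i, j) \<in> skew_cells n l \<and> T i j = k}" for k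
  have cell_cases: "i = 0 \<and> y \<le> j \<and> j < 2 * y \<or> i = 2 \<and> l 2 \<le> j \<and> j < y \<or>
      (\<exists>k. i = k + 3 \<and> l (k + 3) \<le> j \<and> j < n (k + 3))"
    if "(i, j) \<in> skew_cells n l" for i j
    using that shift(2)[of i] l01 n012 by (auto simp: skew_cells_def)
  \<comment> \<open>First \<open>T\<close> is shown to be a tableau with respect to its own content,
    so that the lemma on distinct columns can be used in computing that content.\<close>
  have T: "T \<in> skew_ssyt n l (\<lambda>k. card (C k))"
    unfolding skew_ssyt_def
  proof (intro CollectI conjI allI impI)
    fix i j assume c: "(i, j) \<in> skew_cells n l \<and> (i, Suc j) \<in> skew_cells n l"
    from cell_cases[OF c[THEN conjunct1]] show "T i j \<le> T i (Suc j)"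
    proof (elim disjE exE conjE)
      fix k assume k: "i = k + 3" "l (k + 3) \<le> j" "j < n (k + 3)"
      have j: "Suc j < n (k + 3)" using c k by (simp add: skew_cells_def)
      consider "Suc j < l (k + 2)" | "Suc j = l (k + 2)" | "l (k + 2) \<le> j" by linarith
      then show ?thesis
      proof cases
        case 3
        then have "T' k j \<le> T' k (Suc j)"
          using j by (intro skew_ssyt_row_mono[OF T']) (auto simp: l'_def n'_def)
        then show ?thesis using k j 3 rest[of k j] rest[of k "Suc j"] by simp
      qed (use k j strip[of k j] strip[of k "Suc j"] rest[of k "Suc j"] in auto)
    qed (use c in \<open>auto simp: row0 row2 skew_cells_def\<close>)
  next
    fix i j assume c: "(i, j) \<in> skew_cells n l \<and> (Suc i, j) \<in> skew_cells n l"
    from cell_cases[OF c[THEN conjunct1]] show "T i j < T (Suc i) j"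
    proof (elim disjE exE conjE)
      assume "i = 0" "y \<le> j"
      then show ?thesis using c n012 by (simp add: skew_cells_def)
    next
      assume i: "i = 2" "l 2 \<le> j" "j < y"
      then have "T 3 j = T' 0 j + 2"
        using rest[of 0 j] c by (simp add: skew_cells_def)
      then show ?thesis using i row2[of j] n012 by simp
    next
      fix k assume k: "i = k + 3" "l (k + 3) \<le> j" "j < n (k + 3)"
      have j: "j < n (k + 4)" using c k by (simp add: skew_cells_def add.commute)
      have up: "T (k + 4) j = T' (Suc k) j + 2"
        using rest[of "Suc k" j] k j by (simp add: numeral_3_eq_3 numeral_2_eq_2 eval_nat_numeral)
      show ?thesis
      proof (cases "j < l (k + 2)")
        case True
        then show ?thesis using up k strip[of k j] by (simp add: eval_nat_numeral)
      next
        case False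
        then have "T' k j < T' (Suc k) j"
          using j by (intro skew_ssyt_column_strict[OF T' l' n']) (auto simp: l'_def n'_def eval_nat_numeral)
        then show ?thesis using False up k rest[of k j] by (simp add: eval_nat_numeral)
      qed
    qed
  qed (auto simp: T_def C_def)
  have "card (C k) = m k" for k
  proof -
    consider "k = 0" | "k = 1" | k' where "k = k' + 2" using shift(1)[of k] by blast
    then show ?thesis
    proof cases
      case 1
      have "C 0 = {0} \<times> {y..<2 * y}"
      proof (intro set_eqI iffI)
        fix c assume "c \<in> C 0"
        then obtain i j where c: "c = (i, j)" "(i, j) \<in> skew_cells n l" "T i j = 0"
          by (auto simp: C_def)
        from cell_cases[OF c(2)] show "c \<in> {0} \<times> {y..<2 * y}"
        proof (elim disjE exE conjE)
          fix k assume "i = k + 3" "l (k + 3) \<le> j" "j < n (k + 3)"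
          then show ?thesis using c strip[of k j] rest[of k j] by (cases "j < l (k + 2)") auto
        qed (use c row2[of j] n012 in auto)
      qed (use l01 n012 row0 in \<open>auto simp: C_def skew_cells_def\<close>)
      then show ?thesis using 1 m01 by simp
    next
      case 2
      have "snd ` C 1 = {..<y}"
      proof (intro set_eqI iffI)
        fix j assume "j \<in> snd ` C 1"
        then obtain i where c: "(i, j) \<in> skew_cells n l" "T i j = 1" by (auto simp: C_def)
        from cell_cases[OF c(1)] show "j \<in> {..<y}"
        proof (elim disjE exE conjE)
          fix k assume "i = k + 3" "j < n (k + 3)"
          then show ?thesis using partitions_antimono[OF n, of 3 "k + 3"] n3 by simp
        qed (use c row0 in auto)
      next
        fix j assume "j \<in> {..<y}"
        then have j: "j < y" by simp
        have "l (r + 2) \<le> j" using l' by (simp add: l'_def partitions_def)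
        \<comment> \<open>Row \<open>i + 2\<close> is the first row from row 2 on whose cells may
          start at or before column \<open>j\<close>, so it contains the top cell of that
          column.\<close>
        define i where "i = (LEAST i. l (i + 2) \<le> j)"
        have i: "l (i + 2) \<le> j" unfolding i_def using \<open>l (r + 2) \<le> j\<close> by (rule LeastI)
        have min: "j < l (k + 2)" if "k < i" for k
          using not_less_Least[of k "\<lambda>i. l (i + 2) \<le> j"] that by (simp add: i_def not_le)
        have "(i + 2, j) \<in> C 1"
        proof (cases i)
          case 0
          then show ?thesis using i j n012 row2[of j] by (simp add: C_def skew_cells_def)
        next
          case (Suc k)
          then have k: "l (k + 3) \<le> j" "j < l (k + 2)" using i min[of k] by (simp_all add: eval_nat_numeral)
          then have "(k + 3, j) \<in> C 1"
            using strip[of k j] le[of k] by (simp add: C_def skew_cells_def)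
          then show ?thesis using Suc by (simp add: eval_nat_numeral)
        qed
        then show "j \<in> snd ` C 1" by force
      qed
      moreover have "inj_on snd (C 1)"
        unfolding C_def by (rule inj_on_snd_skew_ssyt_entry[OF T l n])
      ultimately have "card (C 1) = y" by (metis card_image card_lessThan)
      then show ?thesis using 2 m01 by simp
    next
      case 3
      let ?D = "{(i, j). (i, j) \<in> skew_cells n' l' \<and> T' i j = k'}"
      have "C k = (\<lambda>(i, j). (i + 3, j)) ` ?D"
      proof (intro set_eqI iffI)
        fix c assume "c \<in> C k"
        then obtain i j where c: "c = (i, j)" "(i, j) \<in> skew_cells n l" "T i j = k' + 2"
          using 3 by (auto simp: C_def)
        from cell_cases[OF c(2)] show "c \<in> (\<lambda>(i, j). (i + 3, j)) ` ?D"
        proof (elim disjE exE conjE)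
          fix i' assume i': "i = i' + 3" "l (i' + 3) \<le> j" "j < n (i' + 3)"
          have "l (i' + 2) \<le> j" using strip[of i' j] c i' by (cases "l (i' + 2) \<le> j") simp_all
          then have "(i', j) \<in> ?D"
            using c i' rest[of i' j] by (simp add: skew_cells_def l'_def n'_def)
          then show ?thesis using c i' by force
        qed (use c row0 row2[of j] n012 in auto)
      next
        fix c assume "c \<in> (\<lambda>(i, j). (i + 3, j)) ` ?D"
        then obtain i j where c: "c = (i + 3, j)" "l (i + 2) \<le> j" "j < n (i + 3)" "T' i j = k'"
          by (auto simp: skew_cells_def l'_def n'_def)
        then show "c \<in> C k"
          using 3 rest[of i j] l_Suc[of i] by (simp add: C_def skew_cells_def)
      qed
      moreover have "inj_on (\<lambda>(i, j). (i + 3, j)) ?D" by (auto simp: inj_on_def)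
      ultimately have "card (C k) = card ?D" by (simp only: card_image)
      then show ?thesis using skew_ssyt_content[OF T', of k'] 3 by (simp add: m'_def)
    qed
  qed
  then have "T \<in> skew_ssyt n l m" using T by (simp add: skew_ssyt_def)
  moreover have "ballot (reading_word (r + 3) n l T)"
  proof -
    define f where "f i = rev (map (T i) [l i..<n i])" for i
    \<comment> \<open>\<open>R i\<close> is the word read from the rows before row
      \<open>i\<close>.\<close>
    define R where "R i = concat (map f [0..<i])" for i
    have R_Suc: "R (Suc i) = R i @ f i" for i by (simp add: R_def)
    have R: "R 0 = []" "R 1 = f 0" "R 2 = f 0" "R 3 = f 0 @ f 2"
      using l01 n012 by (simp_all add: R_def f_def upt_rec eval_nat_numeral)
    have count_f: "count_list (f i) k = card {j \<in> {l i..<n i}. T i j = k}" for i k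
      unfolding f_def by (rule count_list_row)
    have f0: "count_list (f 0) 0 = y" "count_list (f 0) 1 = 0" "count_list (f 0) 2 = 0"
    proof -
      have "{j \<in> {l 0..<n 0}. T 0 j = 0} = {y..<2 * y}" using row0 l01 n012 by auto
      then show "count_list (f 0) 0 = y" "count_list (f 0) 1 = 0" "count_list (f 0) 2 = 0"
        by (simp_all add: count_f row0)
    qed
    have f2: "count_list (f 2) 1 = y - l 2" "count_list (f 2) 2 = 0"
    proof -
      have "{j \<in> {l 2..<n 2}. T 2 j = 1} = {l 2..<y}" "{j \<in> {l 2..<n 2}. T 2 j = 2} = {}"
        using row2 n012 by auto
      then show "count_list (f 2) 1 = y - l 2" "count_list (f 2) 2 = 0" by (simp_all add: count_f)
    qed
    have f3: "count_list (f (i + 3)) 1 = l (i + 2) - l (i + 3)" for i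
    proof -
      have "{j \<in> {l (i + 3)..<n (i + 3)}. T (i + 3) j = 1} = {l (i + 3)..<l (i + 2)}"
      proof (intro set_eqI iffI)
        fix j assume "j \<in> {j \<in> {l (i + 3)..<n (i + 3)}. T (i + 3) j = 1}"
        then show "j \<in> {l (i + 3)..<l (i + 2)}" using rest[of i j] by (cases "j < l (i + 2)") auto
      qed (use strip[of i] le[of i] in auto)
      then show ?thesis by (simp add: count_f)
    qed
    \<comment> \<open>The strip lengths telescope: exactly \<open>y - l (i + 2)\<close> ones are
      read in rows 0 to \<open>i + 2\<close>.\<close>
    have ones: "count_list (R (i + 3)) 1 + l (i + 2) = y" for i
    proof (induction i)
      case 0
      then show ?case using R f0 f2 l2 by simp
    next
      case (Suc i)
      have "R (Suc i + 3) = R (i + 3) @ f (i + 3)" using R_Suc[of "i + 3"] by simp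
      then show ?case using Suc f3[of i] l_Suc[of i] by (simp add: eval_nat_numeral)
    qed
    \<comment> \<open>A 2 in row \<open>i + 3\<close> is a 0 of \<open>T'\<close> in row
      \<open>i\<close>, hence the top of its column in the smaller shape. This confines it to
      columns from \<open>l (i + 2)\<close> up to \<open>l (i + 1)\<close>, or up to
      \<open>y\<close> for \<open>i = 0\<close> by the bound on \<open>n 3\<close>.\<close>
    have twos: "count_list (f (i + 3)) 2 \<le> (if i = 0 then y else l (i + 1)) - l (i + 2)" for i
    proof -
      have "{j \<in> {l (i + 3)..<n (i + 3)}. T (i + 3) j = 2} \<subseteq> {l (i + 2)..<if i = 0 then y else l (i + 1)}"
      proof
        fix j assume "j \<in> {j \<in> {l (i + 3)..<n (i + 3)}. T (i + 3) j = 2}"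
        then have j: "l (i + 3) \<le> j" "j < n (i + 3)" "T (i + 3) j = 2" by auto
        have l_j: "l (i + 2) \<le> j" using strip[of i j] j by (cases "j < l (i + 2)") auto
        then have "T' i j = 0" using rest[of i j] j by simp
        moreover have "j < l (i + 1)" if i: "i = Suc k" for k
        proof (rule ccontr)
          assume "\<not> j < l (i + 1)"
          then have "T' k j < T' i j"
            using i j by (intro skew_ssyt_column_strict[OF T' l' n']) (auto simp: l'_def n'_def numeral_2_eq_2)
          with \<open>T' i j = 0\<close> show False by simp
        qed
        ultimately show "j \<in> {l (i + 2)..<if i = 0 then y else l (i + 1)}"
          using l_j j n3 by (cases i) auto
      qed
      then have "card {j \<in> {l (i + 3)..<n (i + 3)}. T (i + 3) j = 2}
          \<le> card {l (i + 2)..<if i = 0 then y else l (i + 1)}"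
        by (intro card_mono) auto
      then show ?thesis by (simp add: count_f)
    qed
    \<comment> \<open>All \<open>y\<close> zeros are read in row 0, before any 1, and there are
      never more than \<open>y\<close> ones.\<close>
    have ballot0: "count_list (R (Suc i)) 1 \<le> count_list (R i) 0" for i
    proof -
      have y0: "y \<le> count_list (R (Suc i)) 0" for i
        by (induction i) (use R f0 in \<open>simp_all add: R_Suc\<close>)
      have y1: "count_list (R i) 1 \<le> y" for i
        using shift(2)[of i] ones R f0 by (auto simp: R) (metis le_add1)
      show ?thesis
      proof (cases i)
        case 0
        then show ?thesis using R f0 by simp
      next
        case (Suc k)
        then show ?thesis using y0[of k] y1[of "Suc i"] by simp
      qed
    qed
    have ballot1: "count_list (R (Suc i)) 2 \<le> count_list (R i) 1" for i
    proof -
      \<comment> \<open>The bounds in \<open>twos\<close> telescope as well: through row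
        \<open>i + 3\<close> there are at most \<open>y - l (i + 2)\<close> twos, which is the
        number of ones read before that row.\<close>
      have "count_list (R (i + 4)) 2 + l (i + 2) \<le> y" for i
      proof (induction i)
        case 0
        have "R 4 = R 3 @ f 3" using R_Suc[of 3] by simp
        then show ?case using R f0 f2 twos[of 0] l2 by simp
      next
        case (Suc i)
        have "R (Suc i + 4) = R (i + 4) @ f (Suc i + 3)" using R_Suc[of "i + 4"] by (simp add: eval_nat_numeral)
        moreover have "count_list (f (Suc i + 3)) 2 \<le> l (i + 2) - l (i + 3)"
          using twos[of "Suc i"] by (simp add: eval_nat_numeral)
        ultimately show ?case using Suc l_Suc[of i] by (simp add: eval_nat_numeral)
      qed
      then have big: "count_list (R (k + 4)) 2 \<le> count_list (R (k + 3)) 1" for k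
        using ones[of k] by (metis add_le_cancel_right)
      from shift(2)[of i] show ?thesis
      proof (elim disjE exE)
        fix k assume "i = k + 3"
        then show ?thesis using big[of k] by (simp add: eval_nat_numeral)
      qed (use R f0 f2 in \<open>auto simp: eval_nat_numeral\<close>)
    qed
    have w: "reading_word (r + 3) n l T = concat (map f [0..<r + 3])"
      unfolding reading_word_def f_def ..
    have "drop_letters (reading_word (r + 3) n l T) = reading_word r n' l' T'"
      unfolding l'_def n'_def
      by (rule drop_letters_reading_word) (use row0 row2 strip rest l_Suc le l01 n012 in auto)
    moreover have "count_list u 1 \<le> count_list u 0" "count_list u 2 \<le> count_list u 1"
      if "reading_word (r + 3) n l T = u @ v" for u v
      using that ballot0 ballot1 unfolding w R_def
      by (blast intro: count_list_prefix_le_if_rows)+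
    ultimately show ?thesis
      using w' unfolding ballot_drop_letters_iff[of "reading_word (r + 3) n l T"] by simp
  qed
  ultimately show ?thesis using l m n ln by (auto simp: mem_LR_semigroup)
qed

section \<open>The doubling triples and their decompositions\<close>

primrec doubling_inner :: "nat \<Rightarrow> nat \<Rightarrow> nat" where
  "doubling_inner 0 = (\<lambda>_. 0)"
| "doubling_inner (Suc k) = case_nat (2 ^ k) (case_nat (2 ^ k) (doubling_inner k))"

text \<open>Each \<open>case_nat\<close> prepends a part. For positive \<open>k\<close> the parts
  are \<open>2 ^ k\<close> once, the powers of 2 strictly between \<open>2 ^ k\<close> and 1 three
  times each, and 1 twice. The inner partition, serving as both \<lambda> and \<mu>, has each power
  from \<open>2 ^ (k - 1)\<close> down to 1 twice.\<close>

primrec doubling_outer :: "nat \<Rightarrow> nat \<Rightarrow> nat" where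
  "doubling_outer 0 = (\<lambda>_. 0)"
| "doubling_outer (Suc k) = case_nat (2 ^ Suc k) (case_nat (2 ^ k) (case_nat (2 ^ k) (doubling_outer k)))"

lemma doubling_inner_Suc:
  "doubling_inner (Suc k) 0 = 2 ^ k" "doubling_inner (Suc k) 1 = 2 ^ k"
  "doubling_inner (Suc k) (i + 2) = doubling_inner k i"
  by (simp_all add: numeral_2_eq_2)

lemma doubling_outer_Suc:
  "doubling_outer (Suc k) 0 = 2 * 2 ^ k" "doubling_outer (Suc k) 1 = 2 ^ k"
  "doubling_outer (Suc k) 2 = 2 ^ k" "doubling_outer (Suc k) (i + 3) = doubling_outer k i"
  by (simp_all add: numeral_2_eq_2 numeral_3_eq_3)

lemma doubling_mem_LR_semigroup:
  "(doubling_inner k, doubling_inner k, doubling_outer k) \<in> LR_semigroup (3 * k)"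
proof (induction k)
  case 0
  have "(\<lambda>_. 0) \<in> partitions 0" by (simp add: partitions_def antimono_def)
  moreover have "(\<lambda>_ _. 0) \<in> skew_ssyt (\<lambda>_. 0) (\<lambda>_. 0) (\<lambda>_. 0)"
    by (simp add: skew_ssyt_def skew_cells_def)
  moreover have "ballot (reading_word 0 n l T)" for n l T
    by (simp add: reading_word_def ballot_def)
  ultimately show ?case by (auto simp: mem_LR_semigroup)
next
  case (Suc k)
  have "doubling_outer (Suc k) 3 \<le> 2 ^ k" "doubling_inner (Suc k) 2 \<le> 2 ^ k"
    using doubling_outer_Suc(4)[of k 0] doubling_inner_Suc(3)[of k 0] by (cases k; simp)+
  then have "(doubling_inner (Suc k), doubling_inner (Suc k), doubling_outer (Suc k))
      \<in> LR_semigroup (3 * k + 3)"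
    using Suc by (intro LR_semigroup_insert[where y = "2 ^ k"])
      (simp_all only: doubling_inner_Suc doubling_outer_Suc)
  then show ?case by (simp add: add.commute)
qed

text \<open>
  Each of the equalities below holds for the doubling triple and is the equality case of an
  inequality valid on the whole semigroup, so it is inherited by the summands.
\<close>

lemma doubling_summand_face:
  assumes "(l, m, n) \<in> LR_semigroup (3 * Suc k)" "(l2, m2, n2) \<in> LR_semigroup (3 * Suc k)"
    and l_sum: "\<And>i. l i + l2 i = doubling_inner (Suc k) i"
    and m_sum: "\<And>i. m i + m2 i = doubling_inner (Suc k) i"
    and n_sum: "\<And>i. n i + n2 i = doubling_outer (Suc k) i"
  shows "l 0 = n 1" "l 1 = n 1" "m 0 = n 1" "m 1 = n 1" "n 0 = 2 * n 1" "n 2 = n 1"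
    and "0 < k \<Longrightarrow> n 3 = n 1"
    and "(\<lambda>i. l (i + 2), \<lambda>i. m (i + 2), \<lambda>i. n (i + 3)) \<in> LR_semigroup (3 * k)"
proof -
  have r: "3 * Suc k = Suc (3 * k + 2)" by simp
  have valid: "a 1 \<le> a 0" "b 1 \<le> b 0" "c 2 \<le> c 1" "c 3 \<le> c 2" "c 0 \<le> a 0 + b 0" "a 1 \<le> c 1" "b 1 \<le> c 1"
    if "(a, b, c) \<in> LR_semigroup (3 * Suc k)" for a b c
    using that LR_semigroup_first_part_le[of a b c "3 * k + 2"]
      LR_semigroup_second_part_le[of a b c "3 * k + 2"]
    unfolding r by (auto simp: mem_LR_semigroup intro: partitions_antimono)
  note v = valid[OF assms(1)] valid[OF assms(2)]
  note sums = l_sum[of 0] l_sum[of 1] m_sum[of 0] m_sum[of 1] n_sum[of 0] n_sum[of 1] n_sum[of 2]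
  note sums = sums[unfolded doubling_inner_Suc doubling_outer_Suc]
  show eqs: "l 0 = n 1" "l 1 = n 1" "m 0 = n 1" "m 1 = n 1" "n 0 = 2 * n 1" "n 2 = n 1"
    using v sums by linarith+
  \<comment> \<open>This equality ties the scale of the outermost layer to that of the next one,
    which exists only for positive \<open>k\<close>.\<close>
  show "n 3 = n 1" if "0 < k"
  proof -
    from that obtain k' where "k = Suc k'" by (cases k) auto
    then have "n 3 + n2 3 = 2 ^ k"
      using n_sum[of 3] doubling_outer_Suc(4)[of k 0] doubling_outer_Suc(1)[of k'] by simp
    with v sums show ?thesis by linarith
  qed
  have "doubling_inner k (3 * k) = 0"
    using doubling_mem_LR_semigroup[of k] by (simp add: mem_LR_semigroup partitions_def)
  then have "m (3 * k + 2) = 0" using m_sum[of "3 * k + 2"] unfolding doubling_inner_Suc by simp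
  moreover have "(l, m, n) \<in> LR_semigroup (3 * k + 3)" using assms(1) by (simp add: add.commute)
  ultimately show "(\<lambda>i. l (i + 2), \<lambda>i. m (i + 2), \<lambda>i. n (i + 3)) \<in> LR_semigroup (3 * k)"
    using eqs by (intro LR_semigroup_remove) auto
qed

text \<open>By the tight inequalities all parts of the outermost layer are determined by
  \<open>n 1\<close>; the remaining parts form a summand of the smaller doubling triple, a multiple
  of it by induction. The equality of \<open>n 3\<close> and \<open>n 1\<close> makes the two scales
  agree.\<close>

lemma doubling_summand_multiple:
  assumes "(l, m, n) \<in> LR_semigroup (3 * k)" "(l2, m2, n2) \<in> LR_semigroup (3 * k)"
    and "\<And>i. l i + l2 i = doubling_inner k i"
    and "\<And>i. m i + m2 i = doubling_inner k i"
    and "\<And>i. n i + n2 i = doubling_outer k i"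
  shows "\<exists>t. \<forall>i. l i = t * doubling_inner k i \<and> m i = t * doubling_inner k i \<and> n i = t * doubling_outer k i"
  using assms
proof (induction k arbitrary: l m n l2 m2 n2)
  case 0
  then show ?case by simp
next
  case (Suc k)
  note F = doubling_summand_face[OF Suc.prems]
  \<comment> \<open>The face lemma is applied with the two summands exchanged.\<close>
  have "(\<lambda>i. l2 (i + 2), \<lambda>i. m2 (i + 2), \<lambda>i. n2 (i + 3)) \<in> LR_semigroup (3 * k)"
    by (rule doubling_summand_face(8)[OF Suc.prems(2,1)])
      (use Suc.prems in \<open>simp_all only: add.commute[of "l2 _"] add.commute[of "m2 _"] add.commute[of "n2 _"]\<close>)
  from Suc.IH[OF F(8) this] Suc.prems(3-5)
  obtain t where t: "\<And>i. l (i + 2) = t * doubling_inner k i" "\<And>i. m (i + 2) = t * doubling_inner k i"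
      "\<And>i. n (i + 3) = t * doubling_outer k i"
    by (metis doubling_inner_Suc(3) doubling_outer_Suc(4))
  \<comment> \<open>For \<open>k = 0\<close> the remaining parts are all 0 and leave
    \<open>t\<close> arbitrary, so the scale is read off from \<open>n 1\<close>, the multiplier of
    \<open>2 ^ 0\<close>.\<close>
  define s where "s = (if k = 0 then n 1 else t)"
  have s: "l (i + 2) = s * doubling_inner k i" "m (i + 2) = s * doubling_inner k i"
      "n (i + 3) = s * doubling_outer k i" for i
    using t by (auto simp: s_def)
  have n1: "n 1 = s * 2 ^ k"
  proof (cases k)
    case (Suc k')
    then have "n 1 = n 3" using F(7) by simp
    also have "\<dots> = s * doubling_outer k 0" using s(3)[of 0] by simp
    finally show ?thesis using Suc doubling_outer_Suc(1)[of k'] by simp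
  qed (simp add: s_def)
  have "l i = s * doubling_inner (Suc k) i \<and> m i = s * doubling_inner (Suc k) i \<and>
      n i = s * doubling_outer (Suc k) i" for i
  proof (intro conjI)
    have i2: "i = 0 \<or> i = 1 \<or> (\<exists>j. i = j + 2)" and i3: "i = 0 \<or> i = 1 \<or> i = 2 \<or> (\<exists>j. i = j + 3)"
      by presburger+
    show "l i = s * doubling_inner (Suc k) i" "m i = s * doubling_inner (Suc k) i"
      using i2 F s n1 doubling_inner_Suc by auto
    show "n i = s * doubling_outer (Suc k) i"
      using i3 F s n1 doubling_outer_Suc by auto
  qed
  then show ?case by blast
qed

lemma doubling_mem_hilbert_basis:
  assumes "0 < k"
  shows "(doubling_inner k, doubling_inner k, doubling_outer k) \<in> hilbert_basis (LR_semigroup (3 * k))"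
proof -
  let ?X = "(doubling_inner k, doubling_inner k, doubling_outer k)"
  from assms obtain k' where k: "k = Suc k'" by (cases k) auto
  have pos: "doubling_outer k 0 \<noteq> 0" using k by simp
  have "x = 0 \<or> x' = 0"
    if x: "x \<in> LR_semigroup (3 * k)" "x' \<in> LR_semigroup (3 * k)" "?X = x + x'" for x x'
  proof -
    obtain l m n l' m' n' where xx': "x = (l, m, n)" "x' = (l', m', n')" by (metis prod_cases3)
    have eqs: "doubling_inner k = l + l'" "doubling_inner k = m + m'" "doubling_outer k = n + n'"
      using x(3) unfolding xx' by (metis Pair_inject add_Pair)+
    have sums: "l i + l' i = doubling_inner k i" "m i + m' i = doubling_inner k i"
      "n i + n' i = doubling_outer k i" for i
      using eqs[THEN fun_cong, of i] by (simp_all add: plus_fun_def)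
    then have sums': "l' i + l i = doubling_inner k i" "m' i + m i = doubling_inner k i"
      "n' i + n i = doubling_outer k i" for i
      by (simp_all add: add.commute)
    obtain t where t: "l i = t * doubling_inner k i" "m i = t * doubling_inner k i"
      "n i = t * doubling_outer k i" for i
      using doubling_summand_multiple[OF x(1,2)[unfolded xx'] sums] by blast
    obtain t' where t': "l' i = t' * doubling_inner k i" "m' i = t' * doubling_inner k i"
      "n' i = t' * doubling_outer k i" for i
      using doubling_summand_multiple[OF x(2,1)[unfolded xx'] sums'] by blast
    \<comment> \<open>Comparing the nonzero first parts of \<nu> gives two natural multipliers with
      sum 1, so one of them is 0.\<close>
    have "(t + t') * doubling_outer k 0 = 1 * doubling_outer k 0"
      using sums(3)[of 0] t(3)[of 0] t'(3)[of 0] by (simp add: add_mult_distrib)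
    then have "t + t' = 1" using pos by (metis mult_right_cancel)
    then have "t = 0 \<or> t' = 0" by linarith
    then show ?thesis
    proof
      assume "t = 0"
      then have "l = 0" "m = 0" "n = 0" using t by (auto simp: fun_eq_iff)
      then show ?thesis by (simp add: xx' zero_prod_def)
    next
      assume "t' = 0"
      then have "l' = 0" "m' = 0" "n' = 0" using t' by (auto simp: fun_eq_iff)
      then show ?thesis by (simp add: xx' zero_prod_def)
    qed
  qed
  moreover have "?X \<noteq> 0" using pos by (auto simp: zero_prod_def fun_eq_iff)
  ultimately show ?thesis
    using doubling_mem_LR_semigroup[of k] unfolding hilbert_basis_def by blast
qed

section \<open>Exponential against linear growth\<close>

lemma square_le_power_two: "4 \<le> k \<Longrightarrow> k * k \<le> 2 ^ k" for k :: nat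
proof (induction k rule: dec_induct)
  case (step k)
  have "2 * k + 1 \<le> k * k" using step mult_le_mono1[of 4 k k] by linarith
  then have "Suc k * Suc k \<le> 2 * (k * k)" by simp
  also have "\<dots> \<le> 2 ^ Suc k" using step by simp
  finally show ?case .
qed simp

theorem theoremB1:
  "\<not> (\<exists>a b :: real. \<forall>r::nat. r \<ge> 1 \<longrightarrow>
        (\<forall>(l, m, n) \<in> hilbert_basis (LR_semigroup r). real (n 0) \<le> a * real r + b))"
proof
  assume "\<exists>a b :: real. \<forall>r::nat. r \<ge> 1 \<longrightarrow>
        (\<forall>(l, m, n) \<in> hilbert_basis (LR_semigroup r). real (n 0) \<le> a * real r + b)"
  then obtain a b :: real where ab: "\<And>r l m n. 1 \<le> r \<Longrightarrow> (l, m, n) \<in> hilbert_basis (LR_semigroup r) \<Longrightarrow>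
      real (n 0) \<le> a * real r + b"
    by fast
  \<comment> \<open>With \<open>r = 3 * k\<close> and \<open>k\<close> at least 1, the linear bound
    is at most \<open>(3 * \<bar>a\<bar> + \<bar>b\<bar>) * k\<close>. Taking \<open>k\<close> above
    this coefficient makes it smaller than \<open>k * k\<close>; adding 4 ensures that
    \<open>k * k\<close> is at most \<open>2 ^ k\<close>.\<close>
  obtain k0 :: nat where k0: "3 * \<bar>a\<bar> + \<bar>b\<bar> < real k0" using reals_Archimedean2 by blast
  define k where "k = k0 + 4"
  have k: "3 * \<bar>a\<bar> + \<bar>b\<bar> < real k" "4 \<le> k" using k0 by (auto simp: k_def)
  then obtain k' where k': "k = Suc k'" by (cases k) auto
  have "a * real (3 * k) + b \<le> (3 * \<bar>a\<bar> + \<bar>b\<bar>) * real k"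
  proof -
    have "a * real (3 * k) \<le> \<bar>a\<bar> * real (3 * k)" by (intro mult_right_mono) auto
    moreover have "b \<le> \<bar>b\<bar> * real k" using k mult_left_mono[of 1 "real k" "\<bar>b\<bar>"] by simp
    ultimately show ?thesis by (simp add: algebra_simps)
  qed
  also have "\<dots> < real k * real k" using k by (intro mult_strict_right_mono) auto
  also have "\<dots> \<le> real (2 ^ k)" using square_le_power_two[OF k(2)] by (metis of_nat_le_iff of_nat_mult)
  also have "2 ^ k = doubling_outer k 0" using k' by simp
  also have "real (doubling_outer k 0) \<le> a * real (3 * k) + b"
    using ab[OF _ doubling_mem_hilbert_basis[of k]] k by simp
  finally show False by simp
qed

end
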